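(* Let $\bm{A}=[\bm{A}_1\ \bm{A}_2]\in\mathbb{R}^{m\times(n_1+n_2)}$ have full column rank with $\bm{A}_1^\top\bm{A}_1=\bm{I}_{n_1}$, $\bm{A}_2^\top\bm{A}_2=\bm{I}_{n_2}$, and $\bm{C}:=\bm{A}_2^\top\bm{A}_1\neq0$, with $r:=\operatorname{rank}(\bm{C})$. Let $\rho_{\mathrm{BGD}}^*:=\min_{\gamma_1>0,\gamma_2>0}\rho(\bm{M}(\gamma_1,\gamma_2))$. (i) If $r=\min\{n_1,n_2\}$, then $\rho_{\mathrm{BGD}}^*=\dfrac{\sqrt{1-\lambda_r(\bm{C}\bm{C}^\top)}-\sqrt{1-\lambda_1(\bm{C}\bm{C}^\top)}}{\sqrt{1-\lambda_r(\bm{C}\bm{C}^\top)}+\sqrt{1-\lambda_1(\bm{C}\bm{C}^\top)}}$. (ii) If $r<\min\{n_1,n_2\}$, then $\rho_{\mathrm{BGD}}^*=\dfrac{1-\sqrt{1-\lambda_1(\bm{C}\bm{C}^\top)}}{1+\sqrt{1-\lambda_1(\bm{C}\bm{C}^\top)}}$, attained at $\gamma_1=\gamma_2=\dfrac{2}{1+\sqrt{1-\lambda_1(\bm{C}\bm{C}^\top)}}$.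
   Context: $\lambda_i(\cdot)$ denotes the $i$-th largest eigenvalue of a symmetric matrix; $\rho(\cdot)$ is the spectral radius. For $\gamma_1,\gamma_2>0$, $\bm{M}(\gamma_1,\gamma_2):=\left(\bm{I}-\begin{bmatrix}0&0\\ \gamma_2\bm{A}_2^\top\bm{A}_1&\gamma_2\bm{A}_2^\top\bm{A}_2\end{bmatrix}\right)\left(\bm{I}-\begin{bmatrix}\gamma_1\bm{A}_1^\top\bm{A}_1&\gamma_1\bm{A}_1^\top\bm{A}_2\\0&0\end{bmatrix}\right)$, the iteration matrix of two-block gradient descent with stepsizes $\gamma_1,\gamma_2$ on $\frac12\|\bm{A}\bm{x}-\bm{y}\|_2^2$. *)

theory Defs
  imports "HOL-Analysis.Analysis" "HOL-Computational_Algebra.Polynomial"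
begin

definition hcat :: "real^'a^'m \<Rightarrow> real^'b^'m \<Rightarrow> real^('a + 'b)^'m" where
  "hcat P Q = (\<chi> i j. case j of Inl a \<Rightarrow> P $ i $ a | Inr b \<Rightarrow> Q $ i $ b)"

definition blockmat :: "real^'c^'a \<Rightarrow> real^'d^'a \<Rightarrow> real^'c^'b \<Rightarrow> real^'d^'b
    \<Rightarrow> real^('c + 'd)^('a + 'b)" where
  "blockmat P Q R S = (\<chi> i j. case i of
      Inl a \<Rightarrow> (case j of Inl c \<Rightarrow> P $ a $ c | Inr d \<Rightarrow> Q $ a $ d)
    | Inr b \<Rightarrow> (case j of Inl c \<Rightarrow> R $ b $ c | Inr d \<Rightarrow> S $ b $ d))"

text \<open>Iteration matrix of two-block gradient descent M(gamma1, gamma2).\<close>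
definition BGD_M :: "real^'n1^'m \<Rightarrow> real^'n2^'m \<Rightarrow> real \<Rightarrow> real \<Rightarrow> real^('n1 + 'n2)^('n1 + 'n2)" where
  "BGD_M A1 A2 g1 g2 =
     (mat 1 - blockmat (0 :: real^'n1^'n1) (0 :: real^'n2^'n1)
                 (g2 *\<^sub>R (transpose A2 ** A1)) (g2 *\<^sub>R (transpose A2 ** A2)))
  ** (mat 1 - blockmat (g1 *\<^sub>R (transpose A1 ** A1)) (g1 *\<^sub>R (transpose A1 ** A2))
                 (0 :: real^'n1^'n2) (0 :: real^'n2^'n2))"

definition cmat :: "real^'n^'n \<Rightarrow> complex^'n^'n" where
  "cmat M = (\<chi> i j. complex_of_real (M $ i $ j))"

definition is_eigenvalue :: "real^'n^'n \<Rightarrow> complex \<Rightarrow> bool" where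
  "is_eigenvalue M z \<longleftrightarrow> (\<exists>v. v \<noteq> 0 \<and> cmat M *v v = z *s v)"

definition spectral_radius :: "real^'n^'n \<Rightarrow> real" where
  "spectral_radius M = Max {cmod z | z. is_eigenvalue M z}"

definition charpoly :: "real^'n^'n \<Rightarrow> real poly" where
  "charpoly M = det (\<chi> i j. (if i = j then [:0, 1:] else 0) - [:M $ i $ j:])"

definition sym_eigs :: "real^'n^'n \<Rightarrow> real list" where
  "sym_eigs M = (THE xs. sorted_wrt (\<ge>) xs \<and> charpoly M = (\<Prod>x\<leftarrow>xs. [:- x, 1:]))"

definition lambda_i :: "nat \<Rightarrow> real^'n^'n \<Rightarrow> real" where
  "lambda_i i M = sym_eigs M ! (i - 1)"

definition is_min :: "real set \<Rightarrow> real \<Rightarrow> bool" where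
  "is_min S x \<longleftrightarrow> x \<in> S \<and> (\<forall>y\<in>S. x \<le> y)"

end

theory Submission
  imports Defs
begin

text \<open>Write \<open>s = \<gamma>\<^sub>1 \<gamma>\<^sub>2\<close> and \<open>e = (1 - \<gamma>\<^sub>1) (1 - \<gamma>\<^sub>2)\<close>. Eliminating one block from the eigenvalue
  equation shows that the spectrum of \<open>M(\<gamma>\<^sub>1, \<gamma>\<^sub>2)\<close> consists of the roots of
  \<open>z\<^sup>2 - (1 + e - s \<mu>) z + e\<close>, where \<open>1 - \<mu>\<close> runs over the nonzero eigenvalues of \<open>C C\<^sup>T\<close>, together
  with \<open>1 - \<gamma>\<^sub>1\<close> if \<open>C\<close> has a kernel and \<open>1 - \<gamma>\<^sub>2\<close> if \<open>C\<^sup>T\<close> has one. If all roots lie in the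
  disc of radius \<open>\<rho> < 1\<close>, then \<open>e \<le> \<rho>\<^sup>2\<close> and evaluating the quadratic at \<open>\<rho>\<close> and \<open>- \<rho>\<close> yields
  \<open>(1 - \<rho>)\<^sup>2 \<le> s \<mu> \<le> (1 + \<rho>)\<^sup>2\<close>; if moreover \<open>1 - \<gamma>\<^sub>1\<close> and \<open>1 - \<gamma>\<^sub>2\<close> are eigenvalues, then
  \<open>s \<le> (1 + \<rho>)\<^sup>2\<close>. Comparing the extreme values of \<open>\<mu>\<close> gives the lower bound. It is attained when
  \<open>e = \<rho>\<^sup>2\<close> and the inequalities at the extreme values are equalities, since then every quadratic
  has nonpositive discriminant and both its roots have modulus \<open>\<rho>\<close>.\<close>

section \<open>Diagonalization of real symmetric matrices\<close>

text \<open>A maximizer \<open>u\<close> of \<open>x \<bullet> f x\<close> on the unit sphere of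
  \<open>S\<close> works: by maximality the form
  \<open>c * (y \<bullet> y) - y \<bullet> f y\<close> is nonnegative on \<open>S\<close> and
  vanishes at \<open>u\<close>, so its gradient vanishes there too.\<close>

lemma symmetric_form_max_eigenvector:
  fixes f :: "'a::euclidean_space \<Rightarrow> 'a"
  assumes S: "subspace S" and f: "linear f" and inv: "f ` S \<subseteq> S"
    and sym: "\<And>x y. x \<in> S \<Longrightarrow> y \<in> S \<Longrightarrow> f x \<bullet> y = x \<bullet> f y"
    and S0: "S \<noteq> {0}"
  obtains u c where "u \<in> S" "norm u = 1" "f u = c *\<^sub>R u"
proof -
  obtain x where x: "x \<in> S" "x \<noteq> 0"
    using S0 subspace_0[OF S] by auto
  let ?K = "S \<inter> sphere 0 1"
  have "compact ?K"
    using closed_subspace[OF S] by (simp add: closed_Int_compact)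
  moreover have "x /\<^sub>R norm x \<in> ?K"
    using x S by (simp add: subspace_scale)
  moreover have "continuous_on ?K (\<lambda>x. x \<bullet> f x)"
    using f by (intro continuous_intros linear_continuous_on) (simp add: linear_conv_bounded_linear)
  ultimately obtain u where u: "u \<in> ?K" and umax: "\<And>y. y \<in> ?K \<Longrightarrow> y \<bullet> f y \<le> u \<bullet> f u"
    using continuous_attains_sup[of ?K "\<lambda>x. x \<bullet> f x"] by blast
  define c where "c = u \<bullet> f u"
  have uS: "u \<in> S" and nu: "norm u = 1" using u by auto
  have uu: "u \<bullet> u = 1" using nu by (simp add: norm_eq_1)
  have psd: "0 \<le> c * (y \<bullet> y) - y \<bullet> f y" if y: "y \<in> S" for y
  proof (cases "y = 0")
    case False
    have "y /\<^sub>R norm y \<in> ?K"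
      using y False S by (simp add: subspace_scale)
    from umax[OF this] have "(y \<bullet> f y) / (norm y)\<^sup>2 \<le> c"
      using f by (simp add: c_def linear_scale power2_eq_square field_simps)
    then show ?thesis
      using False by (simp add: field_simps power2_norm_eq_inner)
  qed (simp add: linear_0[OF f])
  define w where "w = c *\<^sub>R u - f u"
  have wS: "w \<in> S"
    unfolding w_def using S uS inv by (auto intro!: subspace_diff subspace_scale)
  define a where "a = w \<bullet> w"
  define b where "b = c * (w \<bullet> w) - w \<bullet> f w"
  have b0: "0 \<le> b" unfolding b_def using psd[OF wS] .
  have quad: "0 \<le> 2 * t * a + t\<^sup>2 * b" for t
  proof -
    have "u + t *\<^sub>R w \<in> S"
      using S uS wS by (intro subspace_add subspace_scale)
    from psd[OF this] have "0 \<le> c * (1 + 2 * t * (u \<bullet> w) + t\<^sup>2 * (w \<bullet> w)) -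
        (c + t * (u \<bullet> f w) + t * (w \<bullet> f u) + t\<^sup>2 * (w \<bullet> f w))"
      using uu by (simp add: linear_add[OF f] linear_scale[OF f] inner_add_left inner_add_right
          c_def[symmetric] inner_commute[of w u] power2_eq_square algebra_simps)
    moreover have "u \<bullet> f w = w \<bullet> f u"
      using sym[OF uS wS] by (simp add: inner_commute)
    moreover have "w \<bullet> f u = c * (u \<bullet> w) - a"
    proof -
      have "a = w \<bullet> (c *\<^sub>R u - f u)" by (simp only: a_def w_def)
      then show ?thesis by (simp add: inner_diff_right inner_commute)
    qed
    ultimately show ?thesis by (simp add: b_def a_def algebra_simps)
  qed
  have "a = 0"
  proof (rule ccontr)
    assume "a \<noteq> 0"
    then have a: "a > 0" by (simp add: a_def)
    \<comment> \<open>A step \<open>t = - q\<close> so short that the linear term wins; the summand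
      1 keeps the denominator positive when \<open>b = 0\<close>.\<close>
    define q where "q = a / (b + 1)"
    have q: "q > 0" "a = q * (b + 1)" using a b0 by (simp_all add: q_def)
    have "2 * (- q) * a + (- q)\<^sup>2 * b = - (q\<^sup>2 * (b + 2))"
      unfolding q(2) by (simp add: power2_eq_square algebra_simps)
    also have "\<dots> < 0"
      using q(1) b0 by simp
    finally show False using quad[of "- q"] by linarith
  qed
  then have "f u = c *\<^sub>R u" by (simp add: a_def w_def)
  with uS nu show ?thesis using that by blast
qed

text \<open>Induction on the dimension: split off a unit eigenvector \<open>u\<close>; by symmetry
  its orthogonal complement in \<open>S\<close> is again invariant. Stating the result for invariant
  subspaces makes the induction hypothesis applicable to that complement.\<close>

lemma symmetric_eigenbasis:
  fixes f :: "'a::euclidean_space \<Rightarrow> 'a"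
  assumes "subspace S" and f: "linear f" and "f ` S \<subseteq> S"
    and "\<And>x y. x \<in> S \<Longrightarrow> y \<in> S \<Longrightarrow> f x \<bullet> y = x \<bullet> f y"
  shows "\<exists>B. pairwise orthogonal B \<and> (\<forall>b\<in>B. norm b = 1 \<and> (\<exists>c. f b = c *\<^sub>R b)) \<and> span B = S"
  using assms(1,3,4)
proof (induction "dim S" arbitrary: S rule: less_induct)
  case less
  note S = less.prems(1) and inv = less.prems(2) and sym = less.prems(3)
  show ?case
  proof (cases "S = {0}")
    case True
    then show ?thesis by (intro exI[of _ "{}"]) simp
  next
    case False
    obtain u c where u: "u \<in> S" "norm u = 1" "f u = c *\<^sub>R u"
      using symmetric_form_max_eigenvector[OF S f inv sym False] by blast
    have uu: "u \<bullet> u = 1" using u by (simp add: norm_eq_1)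
    define T where "T = S \<inter> {x. u \<bullet> x = 0}"
    have T: "subspace T"
      unfolding T_def by (intro subspace_inter S subspace_hyperplane)
    have "u \<notin> T" using uu by (simp add: T_def)
    then have "T \<subset> S" using u(1) T_def by blast
    then have dim: "dim T < dim S"
      using dim_psubset[of T S] S T by (simp add: span_eq_iff[THEN iffD2])
    have invT: "f ` T \<subseteq> T"
    proof
      fix y assume "y \<in> f ` T"
      then obtain x where x: "x \<in> S" "u \<bullet> x = 0" "y = f x" by (auto simp: T_def)
      have "u \<bullet> f x = f u \<bullet> x" using sym[OF u(1) x(1)] by simp
      also have "\<dots> = 0" using u x by simp
      finally show "y \<in> T" using x inv by (auto simp: T_def)
    qed
    obtain B where B: "pairwise orthogonal B" "\<forall>b\<in>B. norm b = 1 \<and> (\<exists>c. f b = c *\<^sub>R b)" "span B = T"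
      using less.hyps[OF dim T invT] sym by (auto simp: T_def)
    have BT: "B \<subseteq> T" using B(3) span_superset by blast
    have "pairwise orthogonal (insert u B)"
      using B(1) BT by (auto simp: pairwise_insert orthogonal_def T_def inner_commute)
    moreover have "span (insert u B) = S"
    proof
      show "span (insert u B) \<subseteq> S"
        using BT u(1) S by (intro span_minimal) (auto simp: T_def)
      show "S \<subseteq> span (insert u B)"
      proof
        fix x assume x: "x \<in> S"
        have "x - (u \<bullet> x) *\<^sub>R u \<in> T"
          using x u uu S by (auto simp: T_def inner_diff_right intro!: subspace_diff subspace_scale)
        then show "x \<in> span (insert u B)"
          using B(3) by (auto simp: span_insert)
      qed
    qed
    ultimately show ?thesis
      using B(2) u by (intro exI[of _ "insert u B"]) auto
  qed
qed

definition diag_mat :: "('n::finite \<Rightarrow> 'a::zero) \<Rightarrow> 'a^'n^'n" where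
  "diag_mat d = (\<chi> i j. if i = j then d i else 0)"

lemma diag_mat_vector:
  fixes d :: "'n::finite \<Rightarrow> 'a::semiring_1"
  shows "(diag_mat d *v x) $ i = d i * (x $ i)"
proof -
  have "(\<Sum>j\<in>UNIV. (if i = j then d i else 0) * (x $ j)) = (\<Sum>j\<in>UNIV. if i = j then d i * (x $ j) else 0)"
    by (rule sum.cong) auto
  then show ?thesis by (simp add: diag_mat_def matrix_vector_mult_def)
qed

lemma inner_matrix_vector_transpose:
  fixes A :: "real^'n^'m"
  shows "(A *v x) \<bullet> y = x \<bullet> (transpose A *v y)"
  using dot_lmul_matrix[of x "transpose A" y] by simp

theorem symmetric_matrix_diagonalizable:
  fixes M :: "real^'n^'n"
  assumes "transpose M = M"
  obtains P d where "orthogonal_matrix P" "M = P ** diag_mat d ** transpose P"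
proof -
  obtain B where B: "pairwise orthogonal B" "span B = (UNIV :: (real^'n) set)"
    "\<And>b. b \<in> B \<Longrightarrow> norm b = 1" "\<And>b. b \<in> B \<Longrightarrow> \<exists>c. M *v b = c *\<^sub>R b"
    using symmetric_eigenbasis[of UNIV "(*v) M"] assms
    by (auto simp: inner_matrix_vector_transpose)
  have indep: "independent B"
    using B(1,3) by (intro pairwise_orthogonal_independent) force+
  \<comment> \<open>The orthonormal eigenbasis has as many elements as the index type, so it can be
    indexed by \<open>'n\<close> and its vectors used as the columns of \<open>P\<close>.\<close>
  have "card B = CARD('n)"
    using indep B(2) basis_card_eq_dim[of B UNIV] by (simp add: dim_UNIV)
  moreover have "finite B" using indep by (simp add: independent_imp_finite)
  ultimately obtain h where h: "bij_betw h (UNIV::'n set) B"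
    using finite_same_card_bij[of "UNIV :: 'n set" B] by (metis finite_class.finite_UNIV)
  have hB: "h i \<in> B" for i using bij_betwE[OF h] by simp
  have "\<forall>i. \<exists>c. M *v h i = c *\<^sub>R h i" using B(4)[OF hB] by simp
  then obtain d where d: "\<And>i. M *v h i = d i *\<^sub>R h i" using choice[of "\<lambda>i c. M *v h i = c *\<^sub>R h i"] by blast
  define P :: "real^'n^'n" where "P = (\<chi> i j. h j $ i)"
  have col: "column j P = h j" for j by (simp add: P_def column_def)
  have P: "orthogonal_matrix P"
    unfolding orthogonal_matrix_orthonormal_columns col
  proof (intro conjI allI impI)
    show "norm (h i) = 1" for i using B(3) hB by blast
    fix i j :: 'n assume "i \<noteq> j"
    then have "h i \<noteq> h j" using bij_betw_imp_inj_on[OF h] by (simp add: inj_eq)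
    then show "orthogonal (h i) (h j)" by (rule pairwiseD[OF B(1) hB hB])
  qed
  have "M ** P = P ** diag_mat d"
  proof -
    have "(M ** P) $ i $ j = (M *v h j) $ i" for i j
      by (simp add: matrix_matrix_mult_def matrix_vector_mult_def P_def)
    moreover have "(P ** diag_mat d) $ i $ j = h j $ i * d j" for i j
    proof -
      have "(\<Sum>k\<in>UNIV. h k $ i * (if k = j then d k else 0)) = (\<Sum>k\<in>UNIV. if k = j then h k $ i * d k else 0)"
        by (rule sum.cong) auto
      then show ?thesis by (simp add: diag_mat_def matrix_matrix_mult_def P_def)
    qed
    ultimately show ?thesis by (simp add: vec_eq_iff d mult.commute)
  qed
  then have "M ** (P ** transpose P) = P ** diag_mat d ** transpose P"
    by (metis matrix_mul_assoc)
  then have "M = P ** diag_mat d ** transpose P"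
    using P unfolding orthogonal_matrix_def by (metis matrix_mul_rid)
  with P show ?thesis by (rule that)
qed

section \<open>Sorted eigenvalues and rank\<close>

text \<open>A product of monic linear factors determines its roots with multiplicity. This gives the
  uniqueness behind the definite description in \<open>sym_eigs\<close>.\<close>

lemma prod_list_linear_factors_eq_iff:
  fixes xs ys :: "'a::idom list"
  shows "(\<Prod>x\<leftarrow>xs. [:- x, 1:]) = (\<Prod>x\<leftarrow>ys. [:- x, 1:]) \<longleftrightarrow> mset xs = mset ys"
proof -
  have "proots (\<Prod>x\<leftarrow>xs. [:- x, 1:]) = mset xs" for xs :: "'a list"
  proof (induction xs)
    case (Cons a xs)
    have "(\<Prod>x\<leftarrow>xs. [:- x, 1:]) \<noteq> 0"
      by (auto simp: prod_list_zero_iff)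
    with Cons show ?case by (simp add: proots_mult del: mult_pCons_left)
  qed simp
  moreover have "(\<Prod>x\<leftarrow>xs. [:- x, 1:]) = (\<Prod>p\<in>#mset xs. [:- p, 1:])" for xs :: "'a list"
    by (metis mset_map prod_mset_prod_list)
  ultimately show ?thesis by metis
qed

lemma matrix_diff_ldistrib: "A ** (B - C) = A ** B - A ** C" for A :: "'a::ring_1^'n^'m"
  by (simp add: matrix_matrix_mult_def vec_eq_iff right_diff_distrib sum_subtractf)

lemma matrix_diff_rdistrib: "(B - C) ** A = B ** A - C ** A" for A :: "'a::ring_1^'n^'m"
  by (simp add: matrix_matrix_mult_def vec_eq_iff left_diff_distrib sum_subtractf)

text \<open>Similarity invariance of the determinant over the polynomial ring: \<open>cp\<close>
  embeds real matrices as constant polynomial matrices, and the scalar matrix \<open>X\<close>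
  commutes with every matrix, so conjugation by \<open>P\<close> passes through
  \<open>X - cp A\<close>.\<close>

lemma charpoly_orthogonal_diag:
  assumes "orthogonal_matrix P"
  shows "charpoly (P ** diag_mat d ** transpose P) = (\<Prod>i\<in>UNIV. [:- d i, 1:])"
proof -
  define cp :: "real^'a^'a \<Rightarrow> real poly^'a^'a" where "cp A = (\<chi> i j. [:A $ i $ j:])" for A
  have cp_mult: "cp (A ** B) = cp A ** cp B" for A B
  proof -
    have "(\<Sum>k\<in>K. [:f k:]) = [:\<Sum>k\<in>K. f k:]" for K and f :: "'a \<Rightarrow> real"
      by (induction K rule: infinite_finite_induct) auto
    then show ?thesis by (simp add: cp_def vec_eq_iff matrix_matrix_mult_def mult.commute)
  qed
  have cp_1: "cp (mat 1) = mat 1"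
    by (simp add: cp_def mat_def vec_eq_iff)
  have PP: "cp P ** cp (transpose P) = mat 1"
    using assms by (simp flip: cp_mult add: cp_1 orthogonal_matrix_def)
  define X :: "real poly^'a^'a" where "X = diag_mat (\<lambda>_. [:0, 1:])"
  have X: "X ** A = A ** X" for A
    by (simp add: X_def vec_eq_iff matrix_matrix_mult_def diag_mat_def if_distrib[where f = "\<lambda>t. t * _"]
        if_distrib[where f = "\<lambda>t. _ * t"] mult.commute cong: if_cong)
  have cpd: "charpoly A = det (X - cp A)" for A
    unfolding charpoly_def
    by (rule arg_cong[where f = det]) (simp add: X_def cp_def diag_mat_def vec_eq_iff)
  have "X - cp (P ** diag_mat d ** transpose P) = cp P ** (X - cp (diag_mat d)) ** cp (transpose P)"
  proof -
    have "cp P ** X ** cp (transpose P) = X"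
      by (metis PP X matrix_mul_assoc matrix_mul_rid)
    then show ?thesis
      by (simp add: cp_mult matrix_diff_ldistrib matrix_diff_rdistrib)
  qed
  then have "charpoly (P ** diag_mat d ** transpose P) = det (X - cp (diag_mat d)) * det (cp P ** cp (transpose P))"
    by (simp add: cpd det_mul)
  also have "\<dots> = det (X - cp (diag_mat d))" by (simp add: PP)
  also have "\<dots> = (\<Prod>i\<in>UNIV. [:- d i, 1:])"
    by (subst det_diagonal) (simp_all add: X_def cp_def diag_mat_def)
  finally show ?thesis .
qed

text \<open>The diagonal entries in decreasing order factor the characteristic polynomial, and a
  sorted list is determined by its multiset; hence the description in \<open>sym_eigs\<close>
  denotes this list.\<close>

lemma sym_eigs_orthogonal_diag:
  fixes P :: "real^'n^'n" and d :: "'n \<Rightarrow> real"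
  assumes "orthogonal_matrix P"
  defines "xs \<equiv> sym_eigs (P ** diag_mat d ** transpose P)"
  shows "sorted_wrt (\<ge>) xs" "mset xs = image_mset d (mset_set UNIV)"
proof -
  let ?M = "P ** diag_mat d ** transpose P"
  define ys where "ys = rev (sorted_list_of_multiset (image_mset d (mset_set UNIV)))"
  have ms: "mset ys = image_mset d (mset_set UNIV)" by (simp add: ys_def)
  have srt: "sorted_wrt (\<ge>) ys"
    by (simp add: ys_def sorted_wrt_rev)
  have "(\<Prod>x\<leftarrow>ys. [:- x, 1:]) = (\<Prod>x\<in>#mset ys. [:- x, 1:])"
    by (metis mset_map prod_mset_prod_list)
  also have "\<dots> = (\<Prod>i\<in>UNIV. [:- d i, 1:])"
    by (simp add: ms prod_unfold_prod_mset image_mset.compositionality comp_def)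
  also have "\<dots> = charpoly ?M"
    using charpoly_orthogonal_diag[OF assms(1)] by simp
  finally have cp: "charpoly ?M = (\<Prod>x\<leftarrow>ys. [:- x, 1:])" by simp
  have "xs = ys"
    unfolding xs_def sym_eigs_def
  proof (rule the_equality)
    show "sorted_wrt (\<ge>) ys \<and> charpoly ?M = (\<Prod>x\<leftarrow>ys. [:- x, 1:])"
      using srt cp by simp
  next
    fix zs assume zs: "sorted_wrt (\<ge>) zs \<and> charpoly ?M = (\<Prod>x\<leftarrow>zs. [:- x, 1:])"
    then have "mset zs = mset ys"
      using cp by (simp flip: prod_list_linear_factors_eq_iff)
    then have "sort (rev ys) = rev zs"
      using zs by (intro properties_for_sort) (simp_all add: sorted_wrt_rev)
    moreover have "sort (rev ys) = rev ys"
      using srt by (intro sorted_sort_id) (simp add: sorted_wrt_rev)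
    ultimately have "rev zs = rev ys" by simp
    then show "zs = ys" by simp
  qed
  with srt ms show "sorted_wrt (\<ge>) xs" "mset xs = image_mset d (mset_set UNIV)" by simp_all
qed

section \<open>Rank of diagonalizable matrices and of Gram matrices\<close>

lemma rank_diag_mat:
  fixes d :: "'n::finite \<Rightarrow> real"
  shows "rank (diag_mat d) = card {i. d i \<noteq> 0}"
proof -
  have "range ((*v) (diag_mat d)) = {x::real^'n. \<forall>i. i \<notin> {i. d i \<noteq> 0} \<longrightarrow> x $ i = 0}" (is "_ = ?R")
  proof (intro set_eqI iffI)
    fix x assume "x \<in> ?R"
    then have "x = diag_mat d *v (\<chi> i. x $ i / d i)"
      by (auto simp: vec_eq_iff diag_mat_vector)
    then show "x \<in> range ((*v) (diag_mat d))" by blast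
  qed (auto simp: diag_mat_vector)
  then show ?thesis
    unfolding rank_dim_range using dim_substandard_cart[where 'a = real, of "{i. d i \<noteq> 0}"] by (simp add: dim_vec_eq)
qed

lemma orthogonal_matrix_conj_cancel:
  fixes P :: "real^'n^'n"
  assumes "orthogonal_matrix P"
  shows "transpose P ** (P ** D ** transpose P) ** P = D"
proof -
  have "transpose P ** (P ** D ** transpose P) ** P = (transpose P ** P) ** D ** (transpose P ** P)"
    by (simp add: matrix_mul_assoc)
  then show ?thesis using assms by (simp add: orthogonal_matrix_def)
qed

lemma rank_orthogonal_diag:
  fixes P :: "real^'n^'n"
  assumes P: "orthogonal_matrix P"
  shows "rank (P ** diag_mat d ** transpose P) = card {i. d i \<noteq> 0}"
proof -
  let ?M = "P ** diag_mat d ** transpose P"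
  have "transpose P ** ?M ** P = diag_mat d"
    by (rule orthogonal_matrix_conj_cancel[OF P])
  then have "rank (diag_mat d) \<le> rank ?M"
    by (metis order_trans rank_mul_le_left rank_mul_le_right)
  moreover have "rank ?M \<le> rank (diag_mat d)"
    by (metis order_trans rank_mul_le_left rank_mul_le_right)
  ultimately show ?thesis by (simp add: rank_diag_mat)
qed

text \<open>The squared norm of \<open>transpose C *v y\<close> equals the inner product of
  \<open>C *v (transpose C *v y)\<close> with \<open>y\<close>.\<close>

lemma transpose_mult_self_ker:
  fixes C :: "real^'n^'m"
  assumes "C *v (transpose C *v y) = 0"
  shows "transpose C *v y = 0"
  using inner_matrix_vector_transpose[of C "transpose C *v y" y] assms by simp

text \<open>\<open>C\<close> is injective on the range of its transpose, so it maps that range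
  isomorphically onto the range of \<open>C ** transpose C\<close>.\<close>

lemma rank_mult_transpose:
  fixes C :: "real^'n^'m"
  shows "rank (C ** transpose C) = rank C"
proof -
  have "inj_on ((*v) C) (span (range ((*v) (transpose C))))"
  proof (subst linear_inj_on_iff_eq_0)
    show "\<forall>v\<in>span (range ((*v) (transpose C))). C *v v = 0 \<longrightarrow> v = 0"
      unfolding linear_span_image[OF matrix_vector_mul_linear] span_UNIV
      using transpose_mult_self_ker by blast
  qed (auto simp: subspace_span)
  then have "dim ((*v) C ` range ((*v) (transpose C))) = dim (range ((*v) (transpose C)))"
    by (intro dim_image_eq) auto
  moreover have "(*v) C ` range ((*v) (transpose C)) = range ((*v) (C ** transpose C))"
    by (simp add: image_image matrix_vector_mul_assoc del: transpose_matrix_vector)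
  ultimately show ?thesis
    by (metis rank_dim_range rank_transpose)
qed

text \<open>A decreasing list starts with its \<open>k\<close> positive entries, so index
  \<open>k - 1\<close> holds the last and smallest of them.\<close>

lemma sorted_desc_nth_count_pos:
  fixes xs :: "real list"
  assumes s: "sorted_wrt (\<ge>) xs" and k: "length (filter (\<lambda>x. x > 0) xs) = k" "k > 0"
  shows "xs ! (k - 1) \<in> set xs" "xs ! (k - 1) > 0"
    "\<And>x. x \<in> set xs \<Longrightarrow> x > 0 \<Longrightarrow> xs ! (k - 1) \<le> x"
    "\<And>x. x \<in> set xs \<Longrightarrow> x \<le> xs ! 0"
proof -
  have part: "xs = filter (\<lambda>x. x > 0) xs @ filter (\<lambda>x. \<not> x > 0) xs"
    using s
  proof (induction xs)
    case (Cons a xs)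
    show ?case
    proof (cases "a > 0")
      case False
      then have "\<forall>x\<in>set xs. \<not> x > 0" using Cons.prems by auto
      then show ?thesis using False by simp
    qed (use Cons in simp)
  qed simp
  define ps where "ps = filter (\<lambda>x. x > 0) xs"
  have nth: "xs ! (k - 1) = last ps"
    using k by (subst part) (auto simp: nth_append ps_def last_conv_nth)
  have ne: "ps \<noteq> []" using k by (auto simp: ps_def)
  have last: "last ps \<in> set ps" using ne by simp
  then show "xs ! (k - 1) \<in> set xs" "xs ! (k - 1) > 0"
    unfolding nth by (auto simp: ps_def)
  have srt: "sorted_wrt (\<ge>) ps" using s by (simp add: ps_def sorted_wrt_filter)
  show "xs ! (k - 1) \<le> x" if "x \<in> set xs" "x > 0" for x
  proof -
    have "x \<in> set ps" using that by (simp add: ps_def)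
    then have "x \<in> set (butlast ps @ [last ps])" using ne by simp
    moreover have "sorted_wrt (\<ge>) (butlast ps @ [last ps])" using srt ne by simp
    ultimately show ?thesis unfolding nth by (auto simp: sorted_wrt_append)
  qed
  show "x \<le> xs ! 0" if "x \<in> set xs" for x
    using that s by (cases xs) auto
qed

text \<open>The eigenvalues of \<open>G\<close> are nonnegative and exactly \<open>rank C\<close> of
  them are positive, so position \<open>rank C\<close> of the decreasing list holds the smallest
  nonzero eigenvalue and position 1 the largest.\<close>

lemma gram_diagonalization:
  fixes C :: "real^'n^'m"
  assumes C: "C \<noteq> 0"
  defines "G \<equiv> C ** transpose C"
  obtains P d where "orthogonal_matrix P" "G = P ** diag_mat d ** transpose P" "\<And>i. d i \<ge> 0"
    "lambda_i 1 G \<in> range d" "lambda_i (rank C) G \<in> range d" "lambda_i (rank C) G > 0"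
    "\<And>i. d i \<noteq> 0 \<Longrightarrow> lambda_i (rank C) G \<le> d i" "\<And>i. d i \<le> lambda_i 1 G"
proof -
  have "transpose G = G"
    by (simp add: G_def matrix_transpose_mul)
  then obtain P d where P: "orthogonal_matrix P" and G: "G = P ** diag_mat d ** transpose P"
    using symmetric_matrix_diagonalizable by blast
  have d0: "d i \<ge> 0" for i
  proof -
    define T where "T = transpose C ** P"
    have "diag_mat d = transpose P ** G ** P"
      unfolding G by (rule orthogonal_matrix_conj_cancel[OF P, symmetric])
    also have "\<dots> = transpose T ** T"
      by (simp add: T_def G_def matrix_transpose_mul matrix_mul_assoc)
    finally have "diag_mat d $ i $ i = (transpose T ** T) $ i $ i"
      by simp
    \<comment> \<open>Each diagonal entry is the squared norm of a column of
      \<open>T\<close>.\<close>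
    then have "d i = (\<Sum>k\<in>UNIV. T $ k $ i * T $ k $ i)"
      by (simp add: diag_mat_def matrix_matrix_mult_def transpose_def)
    then show ?thesis by (simp add: sum_nonneg)
  qed
  define xs where "xs = sym_eigs G"
  have xs: "sorted_wrt (\<ge>) xs" "mset xs = image_mset d (mset_set UNIV)"
    unfolding xs_def G using sym_eigs_orthogonal_diag[OF P] by auto
  have set_xs: "set xs = range d"
    by (metis xs(2) finite set_image_mset finite_set_mset_mset_set set_mset_mset)
  have "length (filter (\<lambda>x. x > 0) xs) = size (filter_mset (\<lambda>x. x > 0) (mset xs))"
    by (metis mset_filter size_mset)
  also have "\<dots> = card {i. d i > 0}"
    by (simp add: xs(2) filter_mset_image_mset filter_mset_mset_set)
  also have "{i. d i > 0} = {i. d i \<noteq> 0}"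
    using d0 by (auto simp: order_less_le)
  also have "card \<dots> = rank C"
    using rank_orthogonal_diag[OF P, of d] rank_mult_transpose[of C] G by (simp add: G_def)
  finally have len: "length (filter (\<lambda>x. x > 0) xs) = rank C" .
  have "rank C > 0" using C rank_eq_0 by (metis gr0I)
  note srt = sorted_desc_nth_count_pos[OF xs(1) len this]
  have "xs \<noteq> []" using set_xs by auto
  then have "xs ! 0 \<in> range d" using set_xs by (metis length_greater_0_conv nth_mem)
  show ?thesis
  proof (rule that[OF P G d0])
    show "lambda_i 1 G \<in> range d"
      using \<open>xs ! 0 \<in> range d\<close> by (simp add: lambda_i_def xs_def)
    show "lambda_i (rank C) G \<in> range d" "lambda_i (rank C) G > 0"
      using srt(1,2) set_xs by (simp_all add: lambda_i_def xs_def)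
    show "lambda_i (rank C) G \<le> d i" if "d i \<noteq> 0" for i
      using srt(3)[of "d i"] set_xs d0[of i] that by (simp add: lambda_i_def xs_def)
    show "d i \<le> lambda_i 1 G" for i
      using srt(4)[of "d i"] set_xs by (simp add: lambda_i_def xs_def)
  qed
qed

section \<open>Spectrum of the iteration matrix\<close>

abbreviation cmx :: "real^'n^'m \<Rightarrow> complex^'n^'m" where
  "cmx \<equiv> map_matrix complex_of_real"

definition vec_Re :: "complex^'n \<Rightarrow> real^'n" where "vec_Re v = (\<chi> i. Re (v $ i))"
definition vec_Im :: "complex^'n \<Rightarrow> real^'n" where "vec_Im v = (\<chi> i. Im (v $ i))"
definition vec_of_real :: "real^'n \<Rightarrow> complex^'n" where "vec_of_real v = (\<chi> i. complex_of_real (v $ i))"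

lemma vec_eq_0_iff_Re_Im: "v = 0 \<longleftrightarrow> vec_Re v = 0 \<and> vec_Im v = 0"
  by (auto simp: vec_eq_iff vec_Re_def vec_Im_def complex_eq_iff)

lemma vec_of_real_eq_0_iff [simp]: "vec_of_real v = 0 \<longleftrightarrow> v = 0"
  by (simp add: vec_of_real_def vec_eq_iff)

lemma cmx_vec_Re: "vec_Re (cmx A *v v) = A *v vec_Re v"
  and cmx_vec_Im: "vec_Im (cmx A *v v) = A *v vec_Im v"
  by (simp_all add: vec_Re_def vec_Im_def matrix_vector_mult_def map_matrix_def vec_eq_iff)

lemma cmx_vec_of_real: "cmx A *v vec_of_real v = vec_of_real (A *v v)"
  by (simp add: vec_of_real_def matrix_vector_mult_def map_matrix_def vec_eq_iff)

lemma cmx_mult: "cmx (A ** B) = cmx A ** cmx B"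
  by (simp add: matrix_matrix_mult_def map_matrix_def vec_eq_iff)

lemma cmx_mat_1: "cmx (mat 1) = mat 1"
  by (simp add: mat_def map_matrix_def vec_eq_iff)

text \<open>A real matrix acts separately on real and imaginary parts, and one of these is nonzero
  for a nonzero complex vector.\<close>

lemma cmx_vec_eq_0_iff: "(\<exists>v. v \<noteq> 0 \<and> cmx A *v v = 0) \<longleftrightarrow> (\<exists>v. v \<noteq> 0 \<and> A *v v = 0)"
proof
  assume "\<exists>v. v \<noteq> 0 \<and> cmx A *v v = 0"
  then show "\<exists>v. v \<noteq> 0 \<and> A *v v = 0"
    by (metis cmx_vec_Re cmx_vec_Im vec_eq_0_iff_Re_Im)
next
  assume "\<exists>v. v \<noteq> 0 \<and> A *v v = 0"
  then obtain v where "v \<noteq> 0" "A *v v = 0" by blast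
  then show "\<exists>v. v \<noteq> 0 \<and> cmx A *v v = 0"
    by (intro exI[of _ "vec_of_real v"]) (simp add: cmx_vec_of_real)
qed

section \<open>Splitting vectors and matrices into two blocks\<close>

definition vec_Inl :: "'a^('p::finite + 'q::finite) \<Rightarrow> 'a^'p" where "vec_Inl v = (\<chi> i. v $ Inl i)"
definition vec_Inr :: "'a^('p::finite + 'q::finite) \<Rightarrow> 'a^'q" where "vec_Inr v = (\<chi> i. v $ Inr i)"
definition vec_cat :: "'a^'p \<Rightarrow> 'a^'q \<Rightarrow> 'a^('p + 'q)" where
  "vec_cat x y = (\<chi> i. case i of Inl a \<Rightarrow> x $ a | Inr b \<Rightarrow> y $ b)"

lemma vec_Inl_cat [simp]: "vec_Inl (vec_cat x y) = x" and vec_Inr_cat [simp]: "vec_Inr (vec_cat x y) = y"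
  by (simp_all add: vec_Inl_def vec_Inr_def vec_cat_def)

lemma vec_sum_eq_iff: "v = w \<longleftrightarrow> vec_Inl v = vec_Inl w \<and> vec_Inr v = vec_Inr w"
  by (auto simp: vec_Inl_def vec_Inr_def vec_eq_iff split_sum_all)

lemma vec_Inl_diff: "vec_Inl (v - w) = vec_Inl v - vec_Inl w"
  and vec_Inr_diff: "vec_Inr (v - w) = vec_Inr v - vec_Inr w"
  and vec_Inl_smult: "vec_Inl (c *s u) = c *s vec_Inl u"
  and vec_Inr_smult: "vec_Inr (c *s u) = c *s vec_Inr u"
  and vec_Inl_0: "vec_Inl 0 = 0" and vec_Inr_0: "vec_Inr 0 = 0"
  by (simp_all add: vec_Inl_def vec_Inr_def vec_eq_iff)

lemma sum_UNIV_sum_type: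
  fixes f :: "'a::finite + 'b::finite \<Rightarrow> 'c::comm_monoid_add"
  shows "sum f UNIV = (\<Sum>a\<in>UNIV. f (Inl a)) + (\<Sum>b\<in>UNIV. f (Inr b))"
  by (simp add: UNIV_Plus_UNIV[symmetric] sum.Plus comp_def del: UNIV_Plus_UNIV)

lemma hcat_vec: "hcat A B *v v = A *v vec_Inl v + B *v vec_Inr v"
  by (simp add: hcat_def matrix_vector_mult_def vec_eq_iff sum_UNIV_sum_type vec_Inl_def vec_Inr_def)

lemma blockmat_vec:
  "vec_Inl (cmx (blockmat P Q R S) *v v) = cmx P *v vec_Inl v + cmx Q *v vec_Inr v"
  "vec_Inr (cmx (blockmat P Q R S) *v v) = cmx R *v vec_Inl v + cmx S *v vec_Inr v"
  by (simp_all add: blockmat_def map_matrix_def matrix_vector_mult_def vec_eq_iff sum_UNIV_sum_type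
      vec_Inl_def vec_Inr_def)

lemma cmx_scaleR_vec: "cmx (c *\<^sub>R A) *v v = of_real c *s (cmx A *v v)"
  by (simp add: map_matrix_def matrix_vector_mult_def vec_eq_iff sum_distrib_left mult.assoc)

lemma cmx_0_vec: "cmx 0 *v v = 0"
  by (simp add: map_matrix_def matrix_vector_mult_def vec_eq_iff)

lemma cmx_diff_vec: "cmx (A - B) *v v = cmx A *v v - cmx B *v v"
  by (simp add: map_matrix_def matrix_vector_mult_def vec_eq_iff left_diff_distrib sum_subtractf)

text \<open>The iteration updates the first block and then uses the new value to update the second,
  so an eigenvector is characterized by one equation per block.\<close>

lemma is_eigenvalue_BGD_M_iff:
  fixes A1 :: "real^'n1^'m" and A2 :: "real^'n2^'m"
  assumes orth1: "transpose A1 ** A1 = mat 1" and orth2: "transpose A2 ** A2 = mat 1"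
  defines "C \<equiv> transpose A2 ** A1"
  shows "is_eigenvalue (BGD_M A1 A2 g1 g2) z \<longleftrightarrow> (\<exists>x y. (x \<noteq> 0 \<or> y \<noteq> 0)
    \<and> (z - 1 + of_real g1) *s x = (- of_real g1) *s (cmx (transpose C) *v y)
    \<and> (z - 1 + of_real g2) *s y = (- of_real g2 * z) *s (cmx C *v x))"
    (is "_ \<longleftrightarrow> (\<exists>x y. ?Q x y)")
proof -
  have tC: "transpose A1 ** A2 = transpose C" by (simp add: C_def matrix_transpose_mul)
  have cm: "cmat M = cmx M" for M :: "real^'a^'a" by (simp add: cmat_def map_matrix_def)
  have key: "cmat (BGD_M A1 A2 g1 g2) *v v = z *s v \<longleftrightarrow>
     (z - 1 + of_real g1) *s vec_Inl v = (- of_real g1) *s (cmx (transpose C) *v vec_Inr v)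
    \<and> (z - 1 + of_real g2) *s vec_Inr v = (- of_real g2 * z) *s (cmx C *v vec_Inl v)" for v
  proof -
    define x where "x = vec_Inl v"
    define y where "y = vec_Inr v"
    \<comment> \<open>The first block after its update.\<close>
    define x' where "x' = x - of_real g1 *s (x + cmx (transpose C) *v y)"
    have L: "vec_Inl (cmat (BGD_M A1 A2 g1 g2) *v v) = x'"
     and R: "vec_Inr (cmat (BGD_M A1 A2 g1 g2) *v v) = y - of_real g2 *s (cmx C *v x' + y)"
      unfolding cm BGD_M_def cmx_mult
      by (simp_all add: matrix_vector_mul_assoc[symmetric] cmx_diff_vec vec_Inl_diff vec_Inr_diff
          blockmat_vec cmx_scaleR_vec cmx_0_vec cmx_mat_1 orth1 orth2 tC C_def[symmetric]
          x_def y_def x'_def vector_add_ldistrib)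
    have "cmat (BGD_M A1 A2 g1 g2) *v v = z *s v \<longleftrightarrow>
      x' = z *s x \<and> y - of_real g2 *s (cmx C *v x' + y) = z *s y"
      by (simp add: vec_sum_eq_iff[of _ "z *s v"] L R vec_Inl_smult vec_Inr_smult x_def y_def)
    \<comment> \<open>The first equation replaces \<open>x'\<close> by \<open>z *s x\<close> in the
      second; this is the origin of the factor \<open>z\<close> there.\<close>
    also have "\<dots> \<longleftrightarrow> x' = z *s x \<and> y - of_real g2 *s (z *s (cmx C *v x) + y) = z *s y"
      by (metis vector_scalar_commute)
    also have "\<dots> \<longleftrightarrow> (z - 1 + of_real g1) *s x = (- of_real g1) *s (cmx (transpose C) *v y)
      \<and> (z - 1 + of_real g2) *s y = (- of_real g2 * z) *s (cmx C *v x)"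
    proof -
      have "x' = z *s x \<longleftrightarrow> (z - 1 + of_real g1) *s x = (- of_real g1) *s (cmx (transpose C) *v y)"
        unfolding x'_def vec_eq_iff by (intro all_cong1) (auto simp: algebra_simps)
      moreover have "y - of_real g2 *s (z *s (cmx C *v x) + y) = z *s y \<longleftrightarrow>
         (z - 1 + of_real g2) *s y = (- of_real g2 * z) *s (cmx C *v x)"
        unfolding vec_eq_iff by (intro all_cong1) (auto simp: algebra_simps)
      ultimately show ?thesis by simp
    qed
    finally show ?thesis unfolding x_def y_def .
  qed
  show ?thesis
  proof
    assume "is_eigenvalue (BGD_M A1 A2 g1 g2) z"
    then obtain v where "v \<noteq> 0" "cmat (BGD_M A1 A2 g1 g2) *v v = z *s v"
      by (auto simp: is_eigenvalue_def)
    then have "?Q (vec_Inl v) (vec_Inr v)"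
      using vec_sum_eq_iff[of v 0] by (auto simp: key vec_Inl_0 vec_Inr_0)
    then show "\<exists>x y. ?Q x y" by blast
  next
    assume "\<exists>x y. ?Q x y"
    then obtain x y where "?Q x y" by blast
    then show "is_eigenvalue (BGD_M A1 A2 g1 g2) z"
      unfolding is_eigenvalue_def
      by (intro exI[of _ "vec_cat x y"]) (auto simp: key vec_sum_eq_iff[of _ 0] vec_Inl_0 vec_Inr_0)
  qed
qed

lemma cmx_diag_mat: "cmx (diag_mat d) = diag_mat (\<lambda>i. complex_of_real (d i))"
  by (simp add: map_matrix_def diag_mat_def vec_eq_iff)

text \<open>The eigenvector is the \<open>i\<close>-th column of \<open>P\<close>.\<close>

lemma orthogonal_diag_eigenvector:
  fixes P :: "real^'n^'n"
  assumes P: "orthogonal_matrix P" and M: "M = P ** diag_mat d ** transpose P"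
  obtains v where "v \<noteq> 0" "M *v v = d i *s v"
proof
  let ?v = "P *v axis i 1"
  have tP: "transpose P *v ?v = axis i 1"
    using P by (simp add: orthogonal_matrix_def matrix_vector_mul_assoc del: transpose_matrix_vector)
  then show "?v \<noteq> 0"
    by (metis axis_eq_0_iff matrix_vector_mult_0_right zero_neq_one)
  have "M *v ?v = P *v (diag_mat d *v (transpose P *v ?v))"
    unfolding M by (simp only: matrix_vector_mul_assoc matrix_mul_assoc)
  also have "\<dots> = P *v (d i *s axis i 1)"
    unfolding tP by (rule arg_cong[where f = "(*v) P"]) (simp add: vec_eq_iff diag_mat_vector axis_def)
  finally show "M *v ?v = d i *s ?v" by (simp add: vector_scalar_commute)
qed

text \<open>The range of \<open>C\<close> meets the kernel of its transpose only in 0; the real case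
  is applied to real and imaginary parts.\<close>

lemma range_inter_ker_transpose_complex:
  fixes C :: "real^'n^'m" and x :: "complex^'n"
  assumes "cmx (transpose C) *v (cmx C *v x) = 0"
  shows "cmx C *v x = 0"
proof -
  have real: "C *v u = 0" if "transpose C *v (C *v u) = 0" for u
    using transpose_mult_self_ker[of "transpose C" u] that by (simp del: transpose_matrix_vector)
  have "transpose C *v (C *v vec_Re x) = 0" "transpose C *v (C *v vec_Im x) = 0"
    using assms vec_eq_0_iff_Re_Im by (metis cmx_vec_Re, metis cmx_vec_Im vec_eq_0_iff_Re_Im)
  then show ?thesis
    using real by (simp add: vec_eq_0_iff_Re_Im cmx_vec_Re cmx_vec_Im)
qed

text \<open>Eliminating \<open>x\<close> leaves an equation for \<open>y\<close> that becomes scalar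
  in each coordinate of the eigenbasis \<open>P\<close>. Zero entries of \<open>d\<close> and the
  case \<open>y = 0\<close> lead to the kernels; the converse uses explicit eigenvectors.\<close>

lemma BGD_M_eigenvalue_cases:
  fixes A1 :: "real^'n1^'m" and A2 :: "real^'n2^'m" and P :: "real^'n2^'n2"
  assumes orth1: "transpose A1 ** A1 = mat 1" and orth2: "transpose A2 ** A2 = mat 1"
    and C: "C = transpose A2 ** A1"
    and P: "orthogonal_matrix P" and G: "C ** transpose C = P ** diag_mat d ** transpose P"
    and d: "\<exists>i. d i \<noteq> 0" and g: "g1 > 0" "g2 > 0"
  shows "is_eigenvalue (BGD_M A1 A2 g1 g2) z \<longleftrightarrow>
      (\<exists>i. d i \<noteq> 0 \<and> (z - 1 + of_real g1) * (z - 1 + of_real g2) = of_real (g1 * g2 * d i) * z)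
    \<or> (z = of_real (1 - g1) \<and> (\<exists>x. x \<noteq> 0 \<and> C *v x = 0))
    \<or> (z = of_real (1 - g2) \<and> (\<exists>y. y \<noteq> 0 \<and> transpose C *v y = 0))"
    (is "_ \<longleftrightarrow> ?A \<or> ?B \<or> ?D")
proof -
  note vector_sadd_rdistrib [simp del] and vector_sub_rdistrib [simp del]
  define T where "T = transpose C"
  define a b where "a = complex_of_real g1" and "b = complex_of_real g2"
  have ab: "a \<noteq> 0" "b \<noteq> 0" using g by (simp_all add: a_def b_def)
  have ev: "is_eigenvalue (BGD_M A1 A2 g1 g2) z \<longleftrightarrow> (\<exists>x y. (x \<noteq> 0 \<or> y \<noteq> 0)
    \<and> (z - 1 + a) *s x = (- a) *s (cmx T *v y) \<and> (z - 1 + b) *s y = (- b * z) *s (cmx C *v x))"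
    unfolding a_def b_def T_def C by (rule is_eigenvalue_BGD_M_iff[OF orth1 orth2])
  have CT: "cmx C *v (cmx T *v y) = cmx (C ** T) *v y" for y
    by (simp add: cmx_mult matrix_vector_mul_assoc)
  have G': "C ** T = P ** diag_mat d ** transpose P" using G by (simp add: T_def)
  \<comment> \<open>Degenerate case: if a step size is 1, then 0 solves the quadratic equation of
    every \<open>i\<close>, and some \<open>i\<close> has \<open>d i \<noteq> 0\<close>.\<close>
  have zero: ?A if "z = 0" "a = 1 \<or> b = 1"
    using that d by (auto simp: a_def b_def)
  have "?A \<or> ?B \<or> ?D"
    if nz: "x \<noteq> 0 \<or> y \<noteq> 0" and e1: "(z - 1 + a) *s x = (- a) *s (cmx T *v y)"
      and e2: "(z - 1 + b) *s y = (- b * z) *s (cmx C *v x)" for x y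
  proof (cases "y = 0")
    case True
    then have x: "x \<noteq> 0" using nz by simp
    have "(z - 1 + a) *s x = 0" unfolding e1 using True by simp
    then have "z - 1 + a = 0" using x by (simp only: vector_mul_eq_0) simp
    then have z: "z = 1 - a" by (simp add: algebra_simps)
    have "z = 0 \<or> cmx C *v x = 0" using e2 True ab by (auto simp: vector_mul_eq_0)
    then show ?thesis
    proof
      assume "z = 0" then show ?thesis using z zero by simp
    next
      assume "cmx C *v x = 0"
      then have "\<exists>x. x \<noteq> 0 \<and> C *v x = 0" using x cmx_vec_eq_0_iff by blast
      then show ?thesis using z by (simp add: a_def)
    qed
  next
    case False
    have "((z - 1 + a) * (z - 1 + b)) *s y = (z - 1 + a) *s ((- b * z) *s (cmx C *v x))"
      by (simp only: e2[symmetric] vector_smult_assoc)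
    also have "\<dots> = (- b * z) *s (cmx C *v ((z - 1 + a) *s x))"
      by (simp only: vector_scalar_commute vector_smult_assoc mult.commute)
    also have "\<dots> = (a * b * z) *s (cmx (C ** T) *v y)"
      unfolding e1 vector_scalar_commute CT by (simp add: vector_smult_assoc mult_ac)
    finally have Gy: "((z - 1 + a) * (z - 1 + b)) *s y = (a * b * z) *s (cmx (C ** T) *v y)" .
    \<comment> \<open>Coordinates of \<open>y\<close> in the eigenbasis; any nonzero coordinate
      yields the scalar equation.\<close>
    define w where "w = cmx (transpose P) *v y"
    have "P ** transpose P = mat 1" "transpose P ** P = mat 1" using P by (simp_all add: orthogonal_matrix_def)
    then have Pw: "cmx P *v w = y"
      unfolding w_def matrix_vector_mul_assoc cmx_mult[symmetric] by (simp add: cmx_mat_1)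
    have "w \<noteq> 0" using Pw False by auto
    have "transpose P ** (C ** T) = (transpose P ** P) ** diag_mat d ** transpose P"
      unfolding G' by (simp only: matrix_mul_assoc)
    then have PG: "transpose P ** (C ** T) = diag_mat d ** transpose P"
      using P by (simp add: orthogonal_matrix_def)
    have "((z - 1 + a) * (z - 1 + b)) *s w = cmx (transpose P) *v (((z - 1 + a) * (z - 1 + b)) *s y)"
      by (simp only: w_def vector_scalar_commute)
    also have "\<dots> = (a * b * z) *s (cmx (transpose P ** (C ** T)) *v y)"
      unfolding Gy vector_scalar_commute by (simp add: cmx_mult matrix_vector_mul_assoc)
    also have "\<dots> = (a * b * z) *s (diag_mat (\<lambda>i. complex_of_real (d i)) *v w)"
      unfolding PG cmx_mult w_def by (simp only: matrix_vector_mul_assoc[symmetric] cmx_diag_mat)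
    finally have comp: "((z - 1 + a) * (z - 1 + b)) * (w $ i) = (a * b * z) * (complex_of_real (d i) * (w $ i))" for i
      by (metis diag_mat_vector vector_smult_component)
    obtain i where i: "w $ i \<noteq> 0" using \<open>w \<noteq> 0\<close> by (auto simp: vec_eq_iff)
    have root: "(z - 1 + a) * (z - 1 + b) = a * b * z * complex_of_real (d i)"
      using comp[of i] i by (simp add: mult.assoc[symmetric])
    show ?thesis
    proof (cases "d i = 0")
      case False
      then show ?thesis using root by (auto simp: a_def b_def mult_ac)
    next
      case True
      \<comment> \<open>A zero eigenvalue of the Gram matrix gives the transpose of \<open>C\<close>
        a kernel, which settles \<open>z = 1 - g2\<close>.\<close>
      obtain v where v: "v \<noteq> 0" "(C ** T) *v v = d i *s v"
        using orthogonal_diag_eigenvector[OF P G'] by blast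
      then have "C *v (T *v v) = 0" using True by (simp add: matrix_vector_mul_assoc)
      then have "T *v v = 0" unfolding T_def by (rule transpose_mult_self_ker)
      then have ker: "\<exists>y. y \<noteq> 0 \<and> transpose C *v y = 0" using v(1) unfolding T_def by blast
      show ?thesis
      proof (cases "z - 1 + b = 0")
        case True
        then have "z = of_real (1 - g2)" by (simp add: b_def algebra_simps)
        then show ?thesis using ker by blast
      next
        case nb: False
        \<comment> \<open>The remaining possibility is contradictory: the first equation puts
          \<open>y\<close> in the kernel of \<open>T\<close>, the second puts it in the range of
          \<open>C\<close>.\<close>
        then have za: "z - 1 + a = 0" using root True by simp
        then have Ty: "cmx T *v y = 0" using e1 ab by (simp add: vector_mul_eq_0)
        define k where "k = - b * z / (z - 1 + b)"
        have "y = (1 / (z - 1 + b)) *s ((z - 1 + b) *s y)"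
          using nb by (simp add: vector_smult_assoc)
        also have "\<dots> = cmx C *v (k *s x)"
          unfolding e2 by (simp only: vector_scalar_commute vector_smult_assoc) (simp add: k_def)
        finally have y: "y = cmx C *v (k *s x)" .
        then have "y = 0"
          using Ty range_inter_ker_transpose_complex[of C "k *s x"] unfolding T_def by simp
        with False show ?thesis by simp
      qed
    qed
  qed
  moreover have "\<exists>x y. (x \<noteq> 0 \<or> y \<noteq> 0)
    \<and> (z - 1 + a) *s x = (- a) *s (cmx T *v y) \<and> (z - 1 + b) *s y = (- b * z) *s (cmx C *v x)"
    (is "\<exists>x y. ?Q x y") if "?A \<or> ?B \<or> ?D"
    using that
  proof (elim disjE)
    assume ?A
    then obtain i where i: "d i \<noteq> 0" "(z - 1 + a) * (z - 1 + b) = a * b * of_real (d i) * z"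
      by (auto simp: a_def b_def)
    show ?thesis
    proof (cases "z - 1 + a = 0")
      case True
      \<comment> \<open>Here \<open>a = 1\<close> and \<open>z = 0\<close>, so both equations hold
        for \<open>y = 0\<close> and any \<open>x\<close>.\<close>
      then have "z = 0" using i ab by auto
      with True have "?Q (axis undefined 1) 0" by (simp add: axis_eq_0_iff)
      then show ?thesis by blast
    next
      case False
      obtain v where v: "v \<noteq> 0" "(C ** T) *v v = d i *s v"
        using orthogonal_diag_eigenvector[OF P G'] by blast
      define y where "y = vec_of_real v"
      \<comment> \<open>Solution of the first block equation for \<open>x\<close>.\<close>
      define x where "x = (- a / (z - 1 + a)) *s (cmx T *v y)"
      have y0: "y \<noteq> 0" using v(1) by (simp add: y_def)
      have Gy: "cmx (C ** T) *v y = of_real (d i) *s y"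
        unfolding y_def cmx_vec_of_real v(2) by (simp add: vec_of_real_def vec_eq_iff)
      have "cmx C *v x = (- a / (z - 1 + a) * of_real (d i)) *s y"
        by (simp only: x_def vector_scalar_commute CT Gy vector_smult_assoc)
      then have "(- b * z) *s (cmx C *v x) = (a * b * of_real (d i) * z / (z - 1 + a)) *s y"
        by (simp add: vector_smult_assoc mult_ac)
      also have "\<dots> = (z - 1 + b) *s y"
        unfolding i(2)[symmetric] using False by simp
      finally have "?Q x y"
        using y0 False by (simp add: x_def vector_smult_assoc)
      then show ?thesis by blast
    qed
  next
    assume ?B
    then obtain x where "x \<noteq> 0" "cmx C *v x = 0" "z = 1 - a"
      using cmx_vec_eq_0_iff[of C] by (auto simp: a_def)
    then have "?Q x 0" by simp
    then show ?thesis by blast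
  next
    assume ?D
    then obtain y where "y \<noteq> 0" "cmx T *v y = 0" "z = 1 - b"
      using cmx_vec_eq_0_iff[of T] by (auto simp: b_def T_def)
    then have "?Q 0 y" by simp
    then show ?thesis by blast
  qed
  ultimately show ?thesis unfolding ev by blast
qed

section \<open>Optimal step sizes\<close>

text \<open>With nonpositive discriminant the roots are complex conjugates or coincide, so their
  product \<open>e\<close> is the squared modulus.\<close>

lemma quadratic_root_cmod:
  fixes t e :: real and z :: complex
  assumes disc: "t\<^sup>2 \<le> 4 * e" and z: "z\<^sup>2 - of_real t * z + of_real e = 0"
  shows "cmod z = sqrt e"
proof -
  obtain a b where ab: "z = Complex a b" by (cases z)
  have re: "a\<^sup>2 - b\<^sup>2 - t * a + e = 0" and im: "b * (2 * a - t) = 0"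
    using z by (simp_all add: ab complex_eq_iff power2_eq_square algebra_simps)
  have "a\<^sup>2 + b\<^sup>2 = e"
  proof (cases "b = 0")
    case True
    have "(2 * a - t)\<^sup>2 = t\<^sup>2 - 4 * e"
      using re True by (simp add: power2_eq_square algebra_simps)
    then have "(2 * a - t)\<^sup>2 \<le> 0" using disc by linarith
    then have "t = 2 * a" by simp
    then show ?thesis using re True by (simp add: power2_eq_square)
  next
    case False
    then have "t = 2 * a" using im by simp
    then show ?thesis using re by (simp add: power2_eq_square)
  qed
  then show ?thesis by (simp add: ab cmod_def)
qed

text \<open>For roots \<open>u\<close> and \<open>v\<close>, \<open>e = u * v\<close> and the values
  at \<open>\<rho>\<close> and \<open>- \<rho>\<close> are
  \<open>(\<rho> - u) * (\<rho> - v)\<close> and \<open>(\<rho> + u) * (\<rho> + v)\<close>. These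
  are products of nonnegative factors for real roots; for nonreal roots completing the square
  suffices.\<close>

lemma quadratic_roots_bounded:
  fixes t e \<rho> :: real
  assumes bd: "\<And>z. z\<^sup>2 - complex_of_real t * z + of_real e = 0 \<Longrightarrow> cmod z \<le> \<rho>"
  shows "e \<le> \<rho>\<^sup>2" "0 \<le> \<rho>\<^sup>2 - t * \<rho> + e" "0 \<le> \<rho>\<^sup>2 + t * \<rho> + e"
proof -
  have "e \<le> \<rho>\<^sup>2 \<and> 0 \<le> \<rho>\<^sup>2 - t * \<rho> + e \<and> 0 \<le> \<rho>\<^sup>2 + t * \<rho> + e"
  proof (cases "t\<^sup>2 < 4 * e")
    case True
    define z where "z = Complex (t / 2) (sqrt (4 * e - t\<^sup>2) / 2)"
    have "0 \<le> t\<^sup>2" by simp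
    then have e0: "0 \<le> e" using True by linarith
    have sq: "(sqrt (4 * e - t\<^sup>2))\<^sup>2 = 4 * e - t\<^sup>2" using True by simp
    have "z\<^sup>2 - of_real t * z + of_real e = 0"
      using sq by (simp add: z_def complex_eq_iff power2_eq_square field_simps)
    then have "cmod z \<le> \<rho>" by (rule bd)
    moreover have "(cmod z)\<^sup>2 = e"
      using sq e0 by (simp add: z_def cmod_def power_divide field_simps)
    ultimately have "e \<le> \<rho>\<^sup>2" by (metis norm_ge_zero power_mono)
    moreover have "0 \<le> (\<rho> - t / 2)\<^sup>2" "0 \<le> (\<rho> + t / 2)\<^sup>2" by simp_all
    ultimately show ?thesis using True by (simp add: power2_eq_square algebra_simps)
  next
    case False
    define s where "s = sqrt (t\<^sup>2 - 4 * e)"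
    have s: "s\<^sup>2 = t\<^sup>2 - 4 * e" using False by (simp add: s_def)
    define u v where "u = (t + s) / 2" and "v = (t - s) / 2"
    have sum: "t = u + v" by (simp add: u_def v_def field_simps)
    have prod: "e = u * v" using s by (simp add: u_def v_def power2_eq_square field_simps)
    have "(complex_of_real u)\<^sup>2 - of_real t * of_real u + of_real e = 0"
         "(complex_of_real v)\<^sup>2 - of_real t * of_real v + of_real e = 0"
      by (simp_all add: sum prod power2_eq_square algebra_simps)
    then have uv: "\<bar>u\<bar> \<le> \<rho>" "\<bar>v\<bar> \<le> \<rho>" using bd by (metis norm_of_real)+
    have "u * v \<le> \<bar>u\<bar> * \<bar>v\<bar>" by (metis abs_ge_self abs_mult)
    also have "\<dots> \<le> \<rho> * \<rho>" using uv by (intro mult_mono) auto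
    finally have "e \<le> \<rho>\<^sup>2" by (simp add: prod power2_eq_square)
    moreover have "0 \<le> (\<rho> - u) * (\<rho> - v)" "0 \<le> (\<rho> + u) * (\<rho> + v)" using uv by auto
    ultimately show ?thesis by (simp add: sum prod power2_eq_square algebra_simps)
  qed
  then show "e \<le> \<rho>\<^sup>2" "0 \<le> \<rho>\<^sup>2 - t * \<rho> + e" "0 \<le> \<rho>\<^sup>2 + t * \<rho> + e" by auto
qed

lemma quadratic_root_exists:
  fixes t e :: complex
  obtains z where "z\<^sup>2 - t * z + e = 0"
proof -
  define s where "s = csqrt (t\<^sup>2 - 4 * e)"
  have "s\<^sup>2 = t\<^sup>2 - 4 * e" by (simp add: s_def)
  then have e: "e = (t * t - s * s) / 4" by (simp add: power2_eq_square)
  have "((t + s) / 2)\<^sup>2 - t * ((t + s) / 2) + e = 0"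
    unfolding e by (simp add: power2_eq_square field_simps)
  then show ?thesis using that by blast
qed

text \<open>Take square roots and eliminate \<open>sqrt s\<close> to get
  \<open>(1 - \<rho>) * sqrt M \<le> (1 + \<rho>) * sqrt m\<close>, then solve for
  \<open>\<rho>\<close>.\<close>

lemma contraction_ratio_le:
  fixes m M s \<rho> :: real
  assumes "0 < m" "m \<le> M" "0 < s" "0 < \<rho>" "\<rho> < 1" "(1 - \<rho>)\<^sup>2 \<le> s * m" "s * M \<le> (1 + \<rho>)\<^sup>2"
  shows "(sqrt M - sqrt m) / (sqrt M + sqrt m) \<le> \<rho>"
proof -
  have "1 - \<rho> \<le> sqrt s * sqrt m"
    using assms by (simp flip: real_sqrt_mult add: real_le_rsqrt)
  moreover have "sqrt s * sqrt M \<le> 1 + \<rho>"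
    using assms by (simp flip: real_sqrt_mult add: real_le_lsqrt)
  ultimately have "(1 - \<rho>) * sqrt M \<le> sqrt s * sqrt m * sqrt M" "sqrt s * sqrt M * sqrt m \<le> (1 + \<rho>) * sqrt m"
    using assms by (auto intro!: mult_right_mono)
  then have "(1 - \<rho>) * sqrt M \<le> (1 + \<rho>) * sqrt m" by (simp add: mult_ac)
  moreover have "sqrt M + sqrt m > 0" using assms by (simp add: add_nonneg_pos)
  ultimately show ?thesis by (simp add: pos_divide_le_eq algebra_simps)
qed

text \<open>The step sizes are the two roots of \<open>g\<^sup>2 - (1 + s - K\<^sup>2) g + s\<close>, where
  \<open>s = 4 / (sqrt M + sqrt m)\<^sup>2\<close>; they are real because \<open>K \<le> sqrt s - 1\<close>.\<close>
lemma optimal_stepsizes_exist: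
  fixes m M :: real
  assumes m: "0 < m" "m \<le> M" "M \<le> 1"
  defines "K \<equiv> (sqrt M - sqrt m) / (sqrt M + sqrt m)"
  obtains h k where "0 < k" "0 < h" "(1 - h) * (1 - k) = K\<^sup>2" "\<bar>1 - k\<bar> \<le> K"
    "h * k * m = (1 - K)\<^sup>2" "h * k * M = (1 + K)\<^sup>2"
proof -
  \<comment> \<open>The square root of the product of the step sizes, chosen so that
    \<open>\<sigma> * sqrt m = 1 - K\<close> and \<open>\<sigma> * sqrt M = 1 + K\<close>.\<close>
  define \<sigma> where "\<sigma> = 2 / (sqrt M + sqrt m)"
  have pos: "sqrt M + sqrt m > 0" and M1: "sqrt M \<le> 1" and mM: "sqrt m \<le> sqrt M"
    using m by (simp_all add: add_nonneg_pos)
  have K0: "0 \<le> K" using pos mM by (simp add: K_def)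
  have "\<sigma> - 1 = (2 - (sqrt M + sqrt m)) / (sqrt M + sqrt m)"
    using pos by (simp add: \<sigma>_def diff_divide_distrib)
  then have \<sigma>K: "K \<le> \<sigma> - 1"
    unfolding K_def using pos M1 by (simp add: divide_right_mono)
  have \<sigma>1: "1 \<le> \<sigma>" using \<sigma>K K0 by linarith
  have mK: "\<sigma> * sqrt m = 1 - K" and MK: "\<sigma> * sqrt M = 1 + K"
    using pos by (simp_all add: K_def \<sigma>_def field_simps)
  define q where "q = 1 + \<sigma>\<^sup>2 - K\<^sup>2"
  have "K\<^sup>2 \<le> (\<sigma> - 1)\<^sup>2" using \<sigma>K K0 by (intro power_mono)
  then have q: "2 * \<sigma> \<le> q" by (simp add: q_def power2_eq_square algebra_simps)
  then have "(2 * \<sigma>)\<^sup>2 \<le> q\<^sup>2" using \<sigma>1 by (intro power_mono) auto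
  then have disc: "0 \<le> q\<^sup>2 - 4 * \<sigma>\<^sup>2" by (simp add: power_mult_distrib)
  define D where "D = sqrt (q\<^sup>2 - 4 * \<sigma>\<^sup>2)"
  have D: "D\<^sup>2 = q\<^sup>2 - 4 * \<sigma>\<^sup>2" "0 \<le> D" using disc by (simp_all add: D_def)
  define h k where "h = (q + D) / 2" and "k = (q - D) / 2"
  have sum: "h + k = q" by (simp add: h_def k_def field_simps)
  have hk: "h * k = \<sigma>\<^sup>2" using D by (simp add: h_def k_def power2_eq_square field_simps)
  have h1: "1 \<le> h" and kh: "k \<le> h" using q D \<sigma>1 by (simp_all add: h_def k_def)
  have k0: "0 < k"
    using hk h1 \<sigma>1 by (metis less_le_trans mult_pos_neg not_less_iff_gr_or_eq order_less_le_trans zero_less_mult_pos zero_less_one zero_less_power)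
  have prod: "(1 - h) * (1 - k) = K\<^sup>2"
    using sum hk by (simp add: q_def algebra_simps)
  \<comment> \<open>Otherwise \<open>h - 1\<close>, being at least \<open>k - 1\<close>, also
    exceeds \<open>K\<close>, and the product exceeds \<open>K\<^sup>2\<close>.\<close>
  have "k - 1 \<le> K"
  proof (rule ccontr)
    assume "\<not> k - 1 \<le> K"
    then have "K * K < (h - 1) * (k - 1)" using K0 kh by (intro mult_strict_mono) auto
    then show False using prod by (simp add: power2_eq_square algebra_simps)
  qed
  \<comment> \<open>Otherwise \<open>k < 1\<close>; the sign of the product and
    \<open>1 \<le> h\<close> force \<open>h = 1\<close>, hence
    \<open>k = \<sigma>\<^sup>2 \<ge> 1\<close>.\<close>
  moreover have "1 - k \<le> K"
  proof (rule ccontr)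
    assume *: "\<not> 1 - k \<le> K"
    then have "k < 1" using K0 by linarith
    moreover have "(1 - h) * (1 - k) \<ge> 0" using prod by simp
    ultimately have "h = 1" using h1 by (auto simp: zero_le_mult_iff)
    then have "k = \<sigma>\<^sup>2" using hk by simp
    then show False using \<open>k < 1\<close> \<sigma>1 by (simp add: one_le_power leD)
  qed
  moreover have "h * k * m = (1 - K)\<^sup>2" "h * k * M = (1 + K)\<^sup>2"
    unfolding hk mK[symmetric] MK[symmetric] using m by (simp_all add: power_mult_distrib)
  ultimately show ?thesis using that[of k h] k0 h1 prod by force
qed

section \<open>Bounds for spectral radius and Gram eigenvalues, and kernels through rank\<close>

lemma spectral_radius_ge:
  assumes "finite {z. is_eigenvalue M z}" "is_eigenvalue M z"
  shows "cmod z \<le> spectral_radius M"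
  unfolding spectral_radius_def using assms
  by (intro Max_ge) (auto simp: setcompr_eq_image)

lemma spectral_radius_eqI:
  assumes "\<And>z. is_eigenvalue M z \<Longrightarrow> cmod z \<le> K" "is_eigenvalue M w" "cmod w = K"
    "finite {z. is_eigenvalue M z}"
  shows "spectral_radius M = K"
  unfolding spectral_radius_def using assms
  by (intro Max_eqI) (auto simp: setcompr_eq_image)

text \<open>The residual of \<open>A\<^sub>2 y\<close> after projection onto the range of \<open>A\<^sub>1\<close> has squared norm
  \<open>(1 - c) \<parallel>y\<parallel>\<^sup>2\<close>.\<close>
lemma gram_eigenvalue_less_1:
  fixes A1 :: "real^'n1^'m" and A2 :: "real^'n2^'m"
  assumes full_rank: "rank (hcat A1 A2) = CARD('n1 + 'n2)"
    and orth1: "transpose A1 ** A1 = mat 1" and orth2: "transpose A2 ** A2 = mat 1"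
    and C: "C = transpose A2 ** A1" and y: "y \<noteq> 0" "(C ** transpose C) *v y = c *s y"
  shows "c < 1"
proof -
  define x where "x = transpose C *v y"
  have x: "x = transpose A1 *v (A2 *v y)"
    by (simp add: x_def C matrix_transpose_mul matrix_vector_mul_assoc del: transpose_matrix_vector)
  have n1: "(A1 *v x) \<bullet> (A1 *v x) = x \<bullet> x"
    unfolding inner_matrix_vector_transpose matrix_vector_mul_assoc orth1 by simp
  have n2: "(A2 *v y) \<bullet> (A2 *v y) = y \<bullet> y"
    unfolding inner_matrix_vector_transpose matrix_vector_mul_assoc orth2 by simp
  have n3: "(A1 *v x) \<bullet> (A2 *v y) = x \<bullet> x"
    unfolding inner_matrix_vector_transpose x[symmetric] ..
  have n4: "x \<bullet> x = c * (y \<bullet> y)"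
  proof -
    have "x \<bullet> x = (C *v x) \<bullet> y" unfolding inner_matrix_vector_transpose[of C] x_def ..
    also have "C *v x = c *s y" unfolding x_def matrix_vector_mul_assoc by (rule y(2))
    finally show ?thesis by (simp add: scalar_mult_eq_scaleR)
  qed
  have inj: "inj ((*v) (hcat A1 A2))"
    using full_rank full_rank_injective by blast
  \<comment> \<open>A zero residual would put the nonzero vector \<open>vec_cat (- x) y\<close> in
    the kernel of the full-rank matrix.\<close>
  have "A2 *v y - A1 *v x \<noteq> 0"
  proof
    assume "A2 *v y - A1 *v x = 0"
    then have "hcat A1 A2 *v vec_cat (- x) y = hcat A1 A2 *v 0"
      by (simp add: hcat_vec linear_neg[OF matrix_vector_mul_linear])
    then have "vec_cat (- x) y = 0" using inj by (simp only: inj_eq)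
    then have "y = 0" by (metis vec_Inr_0 vec_Inr_cat)
    with y show False by simp
  qed
  then have "0 < (A2 *v y - A1 *v x) \<bullet> (A2 *v y - A1 *v x)" by simp
  also have "\<dots> = (1 - c) * (y \<bullet> y)"
    using n1 n2 n3 n4 by (simp add: inner_diff_left inner_diff_right inner_commute algebra_simps)
  finally show ?thesis using inner_ge_zero[of y] by (simp add: zero_less_mult_iff)
qed

lemma ex_ker_iff_rank_less:
  fixes A :: "real^'n^'m"
  shows "(\<exists>x. x \<noteq> 0 \<and> A *v x = 0) \<longleftrightarrow> rank A < CARD('n)"
proof -
  have "rank A \<le> CARD('n)" using rank_bound[of A] by simp
  moreover have "rank A = CARD('n) \<longleftrightarrow> (\<forall>x. A *v x = 0 \<longrightarrow> x = 0)"
    unfolding full_rank_injective by (rule linear_injective_0) simp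
  ultimately show ?thesis by auto
qed

text \<open>\<open>m\<close> and \<open>M\<close> are the extreme values of \<open>1 - d i\<close>
  over the nonzero \<open>d i\<close>. Both are attained, so the necessary conditions on the step
  sizes can be read off at the two extremes.\<close>

locale block_gradient_descent =
  fixes A1 :: "real^'n1::finite^'m::finite" and A2 :: "real^'n2::finite^'m" and C :: "real^'n1^'n2"
    and P :: "real^'n2^'n2" and d :: "'n2 \<Rightarrow> real" and m M :: real
  assumes orth1: "transpose A1 ** A1 = mat 1" and orth2: "transpose A2 ** A2 = mat 1"
    and C: "C = transpose A2 ** A1"
    and P: "orthogonal_matrix P" and gram: "C ** transpose C = P ** diag_mat d ** transpose P"
    and m: "0 < m" "\<exists>i. d i \<noteq> 0 \<and> 1 - d i = m" and M: "M < 1" "\<exists>i. d i \<noteq> 0 \<and> 1 - d i = M"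
    and bounds: "\<And>i. d i \<noteq> 0 \<Longrightarrow> m \<le> 1 - d i" "\<And>i. d i \<noteq> 0 \<Longrightarrow> 1 - d i \<le> M"
begin

lemma m_le_M: "m \<le> M"
  using m(2) bounds(2) by blast

lemma eigenvalue_cases:
  assumes g: "g1 > 0" "g2 > 0"
  shows "is_eigenvalue (BGD_M A1 A2 g1 g2) z \<longleftrightarrow>
      (\<exists>i. d i \<noteq> 0 \<and> z\<^sup>2 - of_real (1 + (1 - g1) * (1 - g2) - g1 * g2 * (1 - d i)) * z
          + of_real ((1 - g1) * (1 - g2)) = 0)
    \<or> (z = of_real (1 - g1) \<and> rank C < CARD('n1)) \<or> (z = of_real (1 - g2) \<and> rank C < CARD('n2))"
proof -
  have quad: "(z - 1 + of_real g1) * (z - 1 + of_real g2) = of_real (g1 * g2 * d i) * z \<longleftrightarrow>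
      z\<^sup>2 - of_real (1 + (1 - g1) * (1 - g2) - g1 * g2 * (1 - d i)) * z
          + of_real ((1 - g1) * (1 - g2)) = 0" for i
  proof -
    have "(z - 1 + of_real g1) * (z - 1 + of_real g2) - of_real (g1 * g2 * d i) * z =
        z\<^sup>2 - of_real (1 + (1 - g1) * (1 - g2) - g1 * g2 * (1 - d i)) * z
          + of_real ((1 - g1) * (1 - g2))"
      by (simp add: power2_eq_square algebra_simps)
    then show ?thesis by (metis eq_iff_diff_eq_0)
  qed
  have "(\<exists>y. y \<noteq> 0 \<and> transpose C *v y = 0) \<longleftrightarrow> rank C < CARD('n2)"
    unfolding ex_ker_iff_rank_less rank_transpose ..
  then show ?thesis
    using BGD_M_eigenvalue_cases[OF orth1 orth2 C P gram _ g, of z] m(2)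
    unfolding quad ex_ker_iff_rank_less by blast
qed

text \<open>\<open>spectral_radius\<close> is a \<open>Max\<close>, so comparing it with the moduli
  of eigenvalues requires finiteness.\<close>

lemma finite_eigenvalues:
  assumes g: "g1 > 0" "g2 > 0"
  shows "finite {z. is_eigenvalue (BGD_M A1 A2 g1 g2) z}"
proof -
  have "finite {z. z\<^sup>2 - t * z + e = 0}" for t e :: complex
  proof -
    have "finite {z. poly [:e, - t, 1:] z = 0}" by (rule poly_roots_finite) simp
    then show ?thesis by (simp add: power2_eq_square algebra_simps)
  qed
  then have "finite ((\<Union>i. {z. z\<^sup>2 - complex_of_real (1 + (1 - g1) * (1 - g2) - g1 * g2 * (1 - d i)) * z
          + of_real ((1 - g1) * (1 - g2)) = 0}) \<union> {of_real (1 - g1), of_real (1 - g2)})"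
    by (intro finite_UnI finite_UN_I) auto
  then show ?thesis
    by (rule finite_subset[rotated]) (auto simp only: eigenvalue_cases[OF g] mem_Collect_eq Un_iff UN_iff insert_iff UNIV_I)
qed

text \<open>Sufficient condition for optimality: \<open>low\<close> and \<open>up\<close> make every
  discriminant nonpositive, so all roots of the quadratics have modulus \<open>K\<close>, and the
  kernel eigenvalues are bounded by \<open>K\<close> by assumption.\<close>

lemma spectral_radius_eq:
  assumes g: "g1 > 0" "g2 > 0" and K: "0 \<le> K" "(1 - g1) * (1 - g2) = K\<^sup>2"
    and low: "(1 - K)\<^sup>2 \<le> g1 * g2 * m" and up: "g1 * g2 * M \<le> (1 + K)\<^sup>2"
    and g1: "rank C < CARD('n1) \<Longrightarrow> \<bar>1 - g1\<bar> \<le> K" and g2: "rank C < CARD('n2) \<Longrightarrow> \<bar>1 - g2\<bar> \<le> K"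
  shows "spectral_radius (BGD_M A1 A2 g1 g2) = K"
proof -
  have root: "cmod z = K"
    if i: "d i \<noteq> 0" and z: "z\<^sup>2 - of_real (1 + (1 - g1) * (1 - g2) - g1 * g2 * (1 - d i)) * z
          + of_real ((1 - g1) * (1 - g2)) = 0" for i z
  proof -
    define t where "t = 1 + K\<^sup>2 - g1 * g2 * (1 - d i)"
    have "g1 * g2 * m \<le> g1 * g2 * (1 - d i)" "g1 * g2 * (1 - d i) \<le> g1 * g2 * M"
      using bounds[OF i] g by (auto intro!: mult_left_mono)
    \<comment> \<open>Equivalent to \<open>g1 * g2 * (1 - d i)\<close> lying between
      \<open>(1 - K)\<^sup>2\<close> and \<open>(1 + K)\<^sup>2\<close>.\<close>
    then have "\<bar>t\<bar> \<le> 2 * K"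
      using low up by (simp add: t_def abs_le_iff power2_eq_square algebra_simps)
    then have "\<bar>t\<bar>\<^sup>2 \<le> (2 * K)\<^sup>2" by (intro power_mono) auto
    then have "cmod z = sqrt (K\<^sup>2)"
      using z unfolding K(2) t_def[symmetric]
      by (intro quadratic_root_cmod[of t]) (simp_all add: power_mult_distrib)
    then show ?thesis using K(1) by simp
  qed
  obtain i where i: "d i \<noteq> 0" using m(2) by blast
  obtain w :: complex where w: "w\<^sup>2 - of_real (1 + (1 - g1) * (1 - g2) - g1 * g2 * (1 - d i)) * w
          + of_real ((1 - g1) * (1 - g2)) = 0"
    by (rule quadratic_root_exists)
  show ?thesis
  proof (rule spectral_radius_eqI)
    show "is_eigenvalue (BGD_M A1 A2 g1 g2) w" using eigenvalue_cases[OF g] i w by blast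
    show "cmod w = K" using root[OF i w] .
    show "finite {z. is_eigenvalue (BGD_M A1 A2 g1 g2) z}" using g by (rule finite_eigenvalues)
    fix z assume "is_eigenvalue (BGD_M A1 A2 g1 g2) z"
    then consider (quad) "cmod z = K" | (ker1) "z = of_real (1 - g1)" "rank C < CARD('n1)"
      | (ker2) "z = of_real (1 - g2)" "rank C < CARD('n2)"
      using root unfolding eigenvalue_cases[OF g] by blast
    then show "cmod z \<le> K"
      using g1 g2 by cases (simp_all only: norm_of_real order_refl)
  qed
qed

lemma eigenvalue_bound_imp:
  assumes g: "g1 > 0" "g2 > 0" and \<rho>: "0 < \<rho>" "\<rho> < 1"
    and bd: "\<And>z. is_eigenvalue (BGD_M A1 A2 g1 g2) z \<Longrightarrow> cmod z \<le> \<rho>"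
  shows "(1 - \<rho>)\<^sup>2 \<le> g1 * g2 * m" "g1 * g2 * M \<le> (1 + \<rho>)\<^sup>2"
proof -
  define e where "e = (1 - g1) * (1 - g2)"
  have *: "(1 - \<rho>)\<^sup>2 \<le> g1 * g2 * (1 - d i) \<and> g1 * g2 * (1 - d i) \<le> (1 + \<rho>)\<^sup>2" if i: "d i \<noteq> 0" for i
  proof -
    define s where "s = g1 * g2 * (1 - d i)"
    have "cmod z \<le> \<rho>" if "z\<^sup>2 - of_real (1 + e - s) * z + of_real e = 0" for z
      using that i eigenvalue_cases[OF g] bd unfolding e_def s_def by blast
    note q = quadratic_roots_bounded[of "1 + e - s" e, OF this]
    \<comment> \<open>These allow \<open>e\<close> to be replaced by \<open>\<rho>\<^sup>2\<close>
      in the values at \<open>\<rho>\<close> and \<open>- \<rho>\<close>, after which a factor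
      \<open>\<rho>\<close> cancels.\<close>
    have "(1 - \<rho>) * (e - \<rho>\<^sup>2) \<le> 0" "(1 + \<rho>) * (e - \<rho>\<^sup>2) \<le> 0"
      using q(1) \<rho> by (auto intro!: mult_nonneg_nonpos)
    then have "\<rho> * (1 - \<rho>)\<^sup>2 \<le> \<rho> * s" "\<rho> * s \<le> \<rho> * (1 + \<rho>)\<^sup>2"
      using q(2,3) by (simp_all add: power2_eq_square algebra_simps)
    then show ?thesis using \<rho>(1) by (simp add: s_def)
  qed
  then show "(1 - \<rho>)\<^sup>2 \<le> g1 * g2 * m" "g1 * g2 * M \<le> (1 + \<rho>)\<^sup>2"
    using m(2) M(2) by blast+
qed

lemma spectral_radius_nonneg:
  assumes g: "g1 > 0" "g2 > 0"
  shows "0 \<le> spectral_radius (BGD_M A1 A2 g1 g2)"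
proof -
  obtain i where i: "d i \<noteq> 0" using m(2) by blast
  obtain w :: complex where "w\<^sup>2 - of_real (1 + (1 - g1) * (1 - g2) - g1 * g2 * (1 - d i)) * w
          + of_real ((1 - g1) * (1 - g2)) = 0"
    by (rule quadratic_root_exists)
  then have "is_eigenvalue (BGD_M A1 A2 g1 g2) w" using eigenvalue_cases[OF g] i by blast
  then show ?thesis
    using spectral_radius_ge[OF finite_eigenvalues[OF g]] norm_ge_zero order_trans by blast
qed

text \<open>Common to both rank cases: \<open>N\<close> is \<open>M\<close> when the rank is maximal
  and 1 when both kernels are nontrivial.\<close>

lemma spectral_radius_lower_bound:
  assumes g: "g1 > 0" "g2 > 0" and N: "m \<le> N"
    and up: "\<And>\<rho>. 0 < \<rho> \<Longrightarrow> \<rho> < 1 \<Longrightarrow>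
      (\<And>z. is_eigenvalue (BGD_M A1 A2 g1 g2) z \<Longrightarrow> cmod z \<le> \<rho>) \<Longrightarrow> g1 * g2 * N \<le> (1 + \<rho>)\<^sup>2"
  shows "(sqrt N - sqrt m) / (sqrt N + sqrt m) \<le> spectral_radius (BGD_M A1 A2 g1 g2)" (is "?K \<le> ?sr")
proof (rule ccontr)
  assume "\<not> ?K \<le> ?sr"
  \<comment> \<open>A value strictly above the spectral radius is positive even if that radius is 0,
    and lies below \<open>?K < 1\<close>.\<close>
  then obtain \<rho> where \<rho>: "?sr < \<rho>" "\<rho> < ?K"
    by (meson dense not_le)
  have "?K < 1" using m(1) N by (simp add: divide_less_eq add_nonneg_pos add_pos_pos)
  have \<rho>01: "0 < \<rho>" "\<rho> < 1" using \<rho> \<open>?K < 1\<close> spectral_radius_nonneg[OF g] by linarith+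
  have bd: "cmod z \<le> \<rho>" if "is_eigenvalue (BGD_M A1 A2 g1 g2) z" for z
    using spectral_radius_ge[OF finite_eigenvalues[OF g] that] \<rho> by simp
  have "?K \<le> \<rho>"
    using contraction_ratio_le[OF m(1) N _ \<rho>01 eigenvalue_bound_imp(1)[OF g \<rho>01 bd] up[OF \<rho>01 bd]] g
    by simp
  with \<rho> show False by simp
qed

text \<open>At most one of \<open>C\<close> and its transpose has a nontrivial kernel, so only one
  step size has to satisfy \<open>\<bar>1 - g\<bar> \<le> K\<close>.\<close>

lemma is_min_full_rank_block:
  assumes "rank C = min CARD('n1) CARD('n2)"
  shows "is_min {spectral_radius (BGD_M A1 A2 g1 g2) | g1 g2. g1 > 0 \<and> g2 > 0}
    ((sqrt M - sqrt m) / (sqrt M + sqrt m))" (is "is_min ?S ?K")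
  unfolding is_min_def
proof
  obtain h k where hk: "0 < k" "0 < h" "(1 - h) * (1 - k) = ?K\<^sup>2" "\<bar>1 - k\<bar> \<le> ?K"
    "h * k * m = (1 - ?K)\<^sup>2" "h * k * M = (1 + ?K)\<^sup>2"
    using optimal_stepsizes_exist[OF m(1) m_le_M] M(1) by (metis less_imp_le)
  have K0: "0 \<le> ?K" using m(1) m_le_M by simp
  \<comment> \<open>The small step size goes to the block whose \<open>1 - \<gamma>\<close> may be an eigenvalue.\<close>
  show "?K \<in> ?S"
  proof (cases "rank C < CARD('n1)")
    case True
    then have "spectral_radius (BGD_M A1 A2 k h) = ?K"
      using hk K0 assms by (intro spectral_radius_eq) (auto simp: mult.commute)
    then show ?thesis using hk by force
  next
    case False
    then have "spectral_radius (BGD_M A1 A2 h k) = ?K"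
      using hk K0 assms by (intro spectral_radius_eq) auto
    then show ?thesis using hk by force
  qed
  show "\<forall>y\<in>?S. ?K \<le> y"
    using spectral_radius_lower_bound[OF _ _ m_le_M] eigenvalue_bound_imp(2) by blast
qed

text \<open>Both \<open>1 - g1\<close> and \<open>1 - g2\<close> are eigenvalues, which bounds
  \<open>g1 * g2\<close> itself by \<open>(1 + \<rho>)\<^sup>2\<close>; thus 1 takes the place of
  \<open>M\<close>.\<close>

lemma rank_deficient_optimum:
  defines "K \<equiv> (1 - sqrt m) / (1 + sqrt m)" and "g \<equiv> 2 / (1 + sqrt m)"
  assumes rank: "rank C < min CARD('n1) CARD('n2)"
  shows "spectral_radius (BGD_M A1 A2 g g) = K"
    and "is_min {spectral_radius (BGD_M A1 A2 g1 g2) | g1 g2. g1 > 0 \<and> g2 > 0} K"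
proof -
  have pos: "0 < 1 + sqrt m" using m(1) by (simp add: add_pos_pos)
  have m1: "m \<le> 1" using m_le_M M(1) by simp
  have K0: "0 \<le> K" using m1 pos m(1) by (simp add: K_def)
  have g0: "0 < g" using pos by (simp add: g_def)
  \<comment> \<open>Hence \<open>(1 - g)\<^sup>2 = K\<^sup>2\<close>, the lower condition is an
    equality, and the upper one follows from \<open>M < 1\<close>.\<close>
  have gK: "g = 1 + K" and gm: "g * sqrt m = 1 - K"
    using pos by (simp_all add: g_def K_def field_simps)
  show sr: "spectral_radius (BGD_M A1 A2 g g) = K"
  proof (rule spectral_radius_eq[OF g0 g0 K0])
    have "(g * sqrt m)\<^sup>2 = g * g * m"
      using m(1) by (simp add: power_mult_distrib power2_eq_square[of g])
    then show "(1 - K)\<^sup>2 \<le> g * g * m" by (simp add: gm)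
    have "g * g * M \<le> g * g * 1" using M(1) g0 by (intro mult_left_mono) auto
    then show "g * g * M \<le> (1 + K)\<^sup>2" by (simp add: gK power2_eq_square)
  qed (use K0 in \<open>simp_all add: gK power2_eq_square\<close>)
  have "K \<le> spectral_radius (BGD_M A1 A2 g1 g2)" if g: "g1 > 0" "g2 > 0" for g1 g2
  proof -
    have "(sqrt 1 - sqrt m) / (sqrt 1 + sqrt m) \<le> spectral_radius (BGD_M A1 A2 g1 g2)"
    proof (rule spectral_radius_lower_bound[OF g m1])
      fix \<rho> :: real assume \<rho>: "0 < \<rho>" "\<rho> < 1"
        and bd: "\<And>z. is_eigenvalue (BGD_M A1 A2 g1 g2) z \<Longrightarrow> cmod z \<le> \<rho>"
      have "is_eigenvalue (BGD_M A1 A2 g1 g2) (of_real (1 - g1))"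
           "is_eigenvalue (BGD_M A1 A2 g1 g2) (of_real (1 - g2))"
        using rank unfolding eigenvalue_cases[OF g] by simp_all
      then have "\<bar>1 - g1\<bar> \<le> \<rho>" "\<bar>1 - g2\<bar> \<le> \<rho>" using bd by (metis norm_of_real)+
      then have "g1 * g2 \<le> (1 + \<rho>) * (1 + \<rho>)" using g \<rho> by (intro mult_mono) auto
      then show "g1 * g2 * 1 \<le> (1 + \<rho>)\<^sup>2" by (simp add: power2_eq_square)
    qed
    then show ?thesis by (simp add: K_def)
  qed
  then show "is_min {spectral_radius (BGD_M A1 A2 g1 g2) | g1 g2. g1 > 0 \<and> g2 > 0} K"
    unfolding is_min_def using sr g0 by force
qed

end

theorem theorem2:
  fixes A1 :: "real^'n1::finite^'m::finite" and A2 :: "real^'n2::finite^'m"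
  assumes full_rank: "rank (hcat A1 A2) = CARD('n1 + 'n2)"
    and orth1: "transpose A1 ** A1 = mat 1"
    and orth2: "transpose A2 ** A2 = mat 1"
    and C_nz: "transpose A2 ** A1 \<noteq> 0"
  defines "r \<equiv> rank (transpose A2 ** A1)"
    and "l1 \<equiv> lambda_i 1 ((transpose A2 ** A1) ** transpose (transpose A2 ** A1))"
    and "lr \<equiv> lambda_i (rank (transpose A2 ** A1)) ((transpose A2 ** A1) ** transpose (transpose A2 ** A1))"
    and "S \<equiv> {spectral_radius (BGD_M A1 A2 g1 g2) | g1 g2. g1 > 0 \<and> g2 > 0}"
  shows "(r = min CARD('n1) CARD('n2) \<longrightarrow>
           is_min S ((sqrt (1 - lr) - sqrt (1 - l1)) / (sqrt (1 - lr) + sqrt (1 - l1))))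
       \<and> (r < min CARD('n1) CARD('n2) \<longrightarrow>
           is_min S ((1 - sqrt (1 - l1)) / (1 + sqrt (1 - l1)))
           \<and> spectral_radius (BGD_M A1 A2 (2 / (1 + sqrt (1 - l1))) (2 / (1 + sqrt (1 - l1))))
               = (1 - sqrt (1 - l1)) / (1 + sqrt (1 - l1)))"
proof -
  define C where "C = transpose A2 ** A1"
  obtain P d where P: "orthogonal_matrix P" and G: "C ** transpose C = P ** diag_mat d ** transpose P"
    and d0: "\<And>i. d i \<ge> 0" and l1: "l1 \<in> range d" and lr: "lr \<in> range d" "lr > 0"
    and lr_le: "\<And>i. d i \<noteq> 0 \<Longrightarrow> lr \<le> d i" and l1_ge: "\<And>i. d i \<le> l1"
    using gram_diagonalization[OF C_nz] unfolding C_def l1_def lr_def by blast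
  have d1: "d i < 1" for i
  proof -
    obtain v where "v \<noteq> 0" "(C ** transpose C) *v v = d i *s v"
      using orthogonal_diag_eigenvector[OF P G] by blast
    then show ?thesis by (rule gram_eigenvalue_less_1[OF full_rank orth1 orth2 C_def])
  qed
  \<comment> \<open>With \<open>lr > 0\<close> this makes both extreme eigenvalues nonzero, as the
    locale requires of the indices attaining \<open>m\<close> and \<open>M\<close>.\<close>
  have "lr \<le> l1" using lr(1) l1_ge by blast
  \<comment> \<open>Passing from \<open>d i\<close> to \<open>1 - d i\<close> reverses the order, so
    the largest eigenvalue gives \<open>m\<close> and the smallest nonzero one gives
    \<open>M\<close>.\<close>
  interpret block_gradient_descent A1 A2 C P d "1 - l1" "1 - lr"
  proof
    show "\<exists>i. d i \<noteq> 0 \<and> 1 - d i = 1 - l1" "\<exists>i. d i \<noteq> 0 \<and> 1 - d i = 1 - lr"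
      using l1 lr \<open>lr \<le> l1\<close> by force+
    show "0 < 1 - l1" using l1 d1 by auto
  qed (use orth1 orth2 C_def P G lr l1_ge lr_le in auto)
  show ?thesis
    using is_min_full_rank_block rank_deficient_optimum unfolding r_def S_def C_def by blast
qed

end
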